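(* Let $\Omega=(\alpha,\beta)$, $-\infty<\alpha<\beta<\infty$, be equipped with the Lebesgue measure. Assume that $\Phi$ is a Musielak-Orlicz function on $\Omega$ such that for some $a,b>0$, \[ \int_\alpha^\beta\Phi(x,b)\,dx<\infty\quad\text{and}\quad \operatorname*{ess\,inf}_{x\in\Omega}\Phi(x,a)>0 . \] Then the Volterra operator \[ Au(x)=\int_\alpha^x u(y)\,dy,\qquad x\in(\alpha,\beta), \] is bounded on $L^\Phi$ (that is, $A$ is a well-defined bounded linear operator from $L^\Phi$ to $L^\Phi$).
   Context: An Orlicz function is a convex function $\varphi:[0,\infty)\to[0,\infty)$, not identically $0$, with $\varphi(0)=\lim_{t\to0+}\varphi(t)=0$. A Musielak-Orlicz (MO) function is a function $\Phi:\Omega\times[0,\infty)\to[0,\infty)$ such that $\Phi(x,\cdot)$ is an Orlicz function for a.a. $x\in\Omega$ and $\Phi(\cdot,t)$ is measurable for every $t\ge0$. The Musielak-Orlicz space $L^\Phi=L^\Phi(\Omega)$ consists of all (classes of) measurable functions $f:\Omega\to\mathbb C$ with $I_\Phi(\lambda f)=\int_\Omega\Phi(x,\lambda|f(x)|)\,dx<\infty$ for some $\lambda>0$, with the Luxemburg norm $\|f\|_\Phi=\inf\{\lambda>0: I_\Phi(f/\lambda)\le1\}$. *)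

theory Defs
  imports "HOL-Analysis.Analysis" "HOL-Probability.Essential_Supremum"
begin

text \<open>A function on the half-line \<open>[0,\<infinity>)\<close> is a function on \<open>real\<close> of which only the
  values at nonnegative arguments are used.\<close>

definition orlicz_function :: "(real \<Rightarrow> real) \<Rightarrow> bool" where
  "orlicz_function \<phi> \<longleftrightarrow>
     (\<forall>t\<ge>0. \<phi> t \<ge> 0) \<and> convex_on {0..} \<phi> \<and> (\<exists>t\<ge>0. \<phi> t \<noteq> 0) \<and>
     \<phi> 0 = 0 \<and> (\<phi> \<longlongrightarrow> 0) (at_right 0)"

definition musielak_orlicz :: "'a measure \<Rightarrow> ('a \<Rightarrow> real \<Rightarrow> real) \<Rightarrow> bool" where
  "musielak_orlicz M \<Phi> \<longleftrightarrow>
     (\<forall>x\<in>space M. \<forall>t\<ge>0. \<Phi> x t \<ge> 0) \<and>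
     (AE x in M. orlicz_function (\<Phi> x)) \<and>
     (\<forall>t\<ge>0. (\<lambda>x. \<Phi> x t) \<in> borel_measurable M)"

definition MO_modular :: "'a measure \<Rightarrow> ('a \<Rightarrow> real \<Rightarrow> real) \<Rightarrow> ('a \<Rightarrow> complex) \<Rightarrow> ennreal" where
  "MO_modular M \<Phi> f = (\<integral>\<^sup>+x. ennreal (\<Phi> x (cmod (f x))) \<partial>M)"

text \<open>The elements of \<open>MO_space M \<Phi>\<close> are the representatives of the classes forming
  \<open>L\<^sup>\<Phi>\<close>; two of them are the same element of \<open>L\<^sup>\<Phi>\<close> if they agree almost everywhere.\<close>

definition MO_space :: "'a measure \<Rightarrow> ('a \<Rightarrow> real \<Rightarrow> real) \<Rightarrow> ('a \<Rightarrow> complex) set" where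
  "MO_space M \<Phi> =
     {f \<in> borel_measurable M. \<exists>r>0. MO_modular M \<Phi> (\<lambda>x. complex_of_real r * f x) < \<infinity>}"

definition luxemburg_norm :: "'a measure \<Rightarrow> ('a \<Rightarrow> real \<Rightarrow> real) \<Rightarrow> ('a \<Rightarrow> complex) \<Rightarrow> real" where
  "luxemburg_norm M \<Phi> f = Inf {r. r > 0 \<and> MO_modular M \<Phi> (\<lambda>x. f x / complex_of_real r) \<le> 1}"

text \<open>\<open>T\<close> acts on representatives. The second conjunct says that it descends to classes; linearity
  is that of the induced map on classes, hence an identity almost everywhere.\<close>

definition MO_bounded_linear_operator ::
    "'a measure \<Rightarrow> ('a \<Rightarrow> real \<Rightarrow> real) \<Rightarrow> (('a \<Rightarrow> complex) \<Rightarrow> 'a \<Rightarrow> complex) \<Rightarrow> bool" where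
  "MO_bounded_linear_operator M \<Phi> T \<longleftrightarrow>
     (\<forall>f\<in>MO_space M \<Phi>. T f \<in> MO_space M \<Phi>) \<and>
     (\<forall>f\<in>MO_space M \<Phi>. \<forall>g\<in>MO_space M \<Phi>.
        (AE x in M. f x = g x) \<longrightarrow> (AE x in M. T f x = T g x)) \<and>
     (\<forall>f\<in>MO_space M \<Phi>. \<forall>g\<in>MO_space M \<Phi>. \<forall>c d.
        AE x in M. T (\<lambda>y. c * f y + d * g y) x = c * T f x + d * T g x) \<and>
     (\<exists>C. \<forall>f\<in>MO_space M \<Phi>. luxemburg_norm M \<Phi> (T f) \<le> C * luxemburg_norm M \<Phi> f)"

definition ess_inf :: "'a measure \<Rightarrow> ('a \<Rightarrow> real) \<Rightarrow> ereal" where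
  "ess_inf M f = - esssup M (\<lambda>x. - ereal (f x))"

definition volterra :: "real \<Rightarrow> (real \<Rightarrow> complex) \<Rightarrow> real \<Rightarrow> complex" where
  "volterra \<alpha> u x = (LINT y:{\<alpha><..<x}|lebesgue. u y)"

end

theory Submission
  imports Defs
begin

text \<open>
  The operator factors through two embeddings, \<open>L\<^sup>\<Phi> \<rightarrow> L\<^sup>1\<close> and \<open>L\<^sup>\<infinity> \<rightarrow> L\<^sup>\<Phi>\<close>: in between, \<open>A\<close> maps
  \<open>L\<^sup>1\<close> to \<open>L\<^sup>\<infinity>\<close> with norm at most one.

  The first embedding comes from the lower bound \<open>c \<le> \<Phi> x a\<close>. By convexity \<open>\<Phi> x\<close> grows beyond \<open>a\<close>
  at least linearly, with slope \<open>c / a\<close>, so that \<open>t \<le> a + (a / c) \<Phi> x t\<close> for every \<open>t \<ge> 0\<close>;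
  integration over the bounded interval gives \<open>\<integral>\<bar>u\<bar> \<le> a (\<beta> - \<alpha>) + a / c\<close> whenever the modular of
  \<open>u\<close> is at most one (\<open>nn_integral_le_modular\<close>).

  The second embedding comes from \<open>B = \<integral>\<Phi> x b < \<infinity>\<close>. By convexity \<open>\<Phi> x (s b) \<le> s \<Phi> x b\<close> for
  \<open>0 \<le> s \<le> 1\<close>, so a function bounded by \<open>s b\<close> has modular at most \<open>s B\<close>
  (\<open>modular_le_of_bounded\<close>), which is at most one for small \<open>s\<close>.

  Together these give a constant \<open>C\<close> such that \<open>u / r\<close> having modular at most one forces
  \<open>A u / (C r)\<close> to have modular at most one (\<open>volterra_modular_le_1\<close>). Passing to the infimum over
  \<open>r\<close> turns this into the inequality of Luxemburg norms.

  The nonnegative integral of an arbitrary integrand is the supremum over its simple minorants. The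
  composite \<open>\<Phi> x (cmod (u x))\<close> is therefore compared, from one side only, with measurable functions
  and with multiples of itself (\<open>nn_integral_cmult_le\<close>), which is legitimate without first
  establishing its measurability.
\<close>

section \<open>Pointwise consequences of convexity\<close>

lemma orlicz_function_scale:
  assumes "orlicz_function \<phi>" "0 \<le> t" "0 \<le> s" "s \<le> 1"
  shows "\<phi> (s * t) \<le> s * \<phi> t"
  using convex_onD[of "{0..}" \<phi> s 0 t] assms by (auto simp: orlicz_function_def)

lemma orlicz_function_mono:
  assumes \<phi>: "orlicz_function \<phi>" and "0 \<le> s" "s \<le> t"
  shows "\<phi> s \<le> \<phi> t"
proof (cases "t = 0")
  case False
  then have "0 < t" using assms by simp
  have "0 \<le> \<phi> t" using \<phi> \<open>0 < t\<close> by (auto simp: orlicz_function_def)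
  have "\<phi> s = \<phi> (s / t * t)" using \<open>0 < t\<close> by simp
  also have "\<dots> \<le> s / t * \<phi> t"
    using assms \<open>0 < t\<close> by (intro orlicz_function_scale) auto
  also have "\<dots> \<le> 1 * \<phi> t"
    using assms \<open>0 < t\<close> \<open>0 \<le> \<phi> t\<close> by (intro mult_right_mono) auto
  finally show ?thesis by simp
qed (use assms in auto)

text \<open>
  Convexity and \<open>\<phi> 0 = 0\<close> make \<open>\<phi> t / t\<close> increasing, so for \<open>t \<ge> a\<close> the graph lies above the line
  through the origin of slope \<open>c / a\<close>. Subtracting \<open>a\<close> and truncating at \<open>0\<close> covers \<open>t < a\<close> as well.
\<close>

lemma orlicz_function_linear_lower_bound:
  assumes \<phi>: "orlicz_function \<phi>" and "0 < a" "0 < c" "c \<le> \<phi> a" "0 \<le> t"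
  shows "max 0 (t - a) \<le> a / c * \<phi> t"
proof (cases "t \<le> a")
  case True
  then show ?thesis using assms by (auto simp: orlicz_function_def)
next
  case False
  have "\<phi> (a / t * t) \<le> a / t * \<phi> t"
    using assms False by (intro orlicz_function_scale) auto
  then have "c \<le> a / t * \<phi> t" using assms False by simp
  then have "t \<le> a / c * \<phi> t" using assms False by (simp add: field_simps)
  then show ?thesis using assms False by auto
qed

section \<open>Two embeddings\<close>

text \<open>
  The integral of an arbitrary \<open>f\<close> is the supremum over its simple minorants, and dividing a simple
  minorant of \<open>c f\<close> by \<open>c\<close> gives one of \<open>f\<close>.
\<close>

lemma nn_integral_cmult_le:
  assumes "0 < c"
  shows "(\<integral>\<^sup>+x. ennreal c * f x \<partial>M) \<le> ennreal c * (\<integral>\<^sup>+x. f x \<partial>M)"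
  unfolding nn_integral_def[of M "\<lambda>x. ennreal c * f x"]
proof (rule SUP_least, clarify)
  fix h assume h: "simple_function M h" and le: "h \<le> (\<lambda>x. ennreal c * f x)"
  have inv: "ennreal (1 / c) * (ennreal c * y) = y" "ennreal c * (ennreal (1 / c) * y) = y" for y
    using assms by (simp_all add: mult.assoc[symmetric] ennreal_mult[symmetric])
  have [measurable]: "h \<in> borel_measurable M"
    using h by (rule borel_measurable_simple_function)
  have "integral\<^sup>S M h = (\<integral>\<^sup>+x. h x \<partial>M)"
    using h by (simp add: nn_integral_eq_simple_integral)
  also have "\<dots> = (\<integral>\<^sup>+x. ennreal c * (ennreal (1 / c) * h x) \<partial>M)"
    by (simp add: inv)
  also have "\<dots> = ennreal c * (\<integral>\<^sup>+x. ennreal (1 / c) * h x \<partial>M)"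
    by (rule nn_integral_cmult) simp
  also have "\<dots> \<le> ennreal c * (\<integral>\<^sup>+x. f x \<partial>M)"
  proof (intro mult_left_mono nn_integral_mono)
    fix x
    have "ennreal (1 / c) * h x \<le> ennreal (1 / c) * (ennreal c * f x)"
      using le by (intro mult_left_mono) (auto simp: le_fun_def)
    then show "ennreal (1 / c) * h x \<le> f x" by (simp only: inv)
  qed simp
  finally show "integral\<^sup>S M h \<le> ennreal c * (\<integral>\<^sup>+x. f x \<partial>M)" .
qed

lemma ess_inf_pos_obtain:
  assumes "0 < ess_inf M f"
  obtains c where "0 < c" "AE x in M. c \<le> f x"
proof -
  obtain c where c: "0 < ereal c" "ereal c < ess_inf M f"
    using ereal_dense2[OF assms] by blast
  have "AE x in M. - ereal (f x) \<le> esssup M (\<lambda>x. - ereal (f x))"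
    by (rule esssup_AE)
  then have "AE x in M. c \<le> f x"
  proof eventually_elim
    case (elim x)
    then have "ess_inf M f \<le> ereal (f x)"
      unfolding ess_inf_def using ereal_uminus_le_reorder by blast
    with c(2) have "ereal c < ereal (f x)" by (rule less_le_trans)
    then show ?case by simp
  qed
  with c(1) that show thesis by simp
qed

text \<open>
  The truncated excess \<open>h = max 0 (\<bar>f\<bar> - a)\<close> is measurable, so \<open>\<bar>f\<bar> \<le> a + h\<close> can be integrated term
  by term, and \<open>h\<close> is dominated pointwise by \<open>(a / c) \<Phi> x \<bar>f\<bar>\<close>.
\<close>

lemma nn_integral_le_modular:
  assumes \<Phi>: "musielak_orlicz M \<Phi>" and "0 < a" "0 < c" and lower: "AE x in M. c \<le> \<Phi> x a"
    and f[measurable]: "f \<in> borel_measurable M"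
  shows "(\<integral>\<^sup>+x. ennreal (cmod (f x)) \<partial>M)
    \<le> ennreal a * emeasure M (space M) + ennreal (a / c) * MO_modular M \<Phi> f"
proof -
  let ?h = "\<lambda>x. max 0 (cmod (f x) - a)"
  have "(\<integral>\<^sup>+x. ennreal (cmod (f x)) \<partial>M) \<le> (\<integral>\<^sup>+x. ennreal a + ennreal (?h x) \<partial>M)"
    using \<open>0 < a\<close> by (intro nn_integral_mono) (simp add: ennreal_plus[symmetric] del: ennreal_plus)
  also have "\<dots> = ennreal a * emeasure M (space M) + (\<integral>\<^sup>+x. ennreal (?h x) \<partial>M)"
    by (subst nn_integral_add) auto
  also have "(\<integral>\<^sup>+x. ennreal (?h x) \<partial>M)
      \<le> (\<integral>\<^sup>+x. ennreal (a / c) * ennreal (\<Phi> x (cmod (f x))) \<partial>M)"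
  proof (rule nn_integral_mono_AE)
    have "AE x in M. orlicz_function (\<Phi> x)"
      using \<Phi> by (simp add: musielak_orlicz_def)
    with lower show "AE x in M. ennreal (?h x) \<le> ennreal (a / c) * ennreal (\<Phi> x (cmod (f x)))"
    proof eventually_elim
      case (elim x)
      then have "?h x \<le> a / c * \<Phi> x (cmod (f x))"
        using assms by (intro orlicz_function_linear_lower_bound) auto
      moreover have "0 \<le> \<Phi> x (cmod (f x))"
        using elim by (simp add: orlicz_function_def)
      ultimately show ?case
        using assms by (simp add: ennreal_mult[symmetric] ennreal_leI)
    qed
  qed
  also have "\<dots> \<le> ennreal (a / c) * MO_modular M \<Phi> f"
    unfolding MO_modular_def using assms by (intro nn_integral_cmult_le) auto
  finally show ?thesis by (simp add: add_left_mono)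
qed

lemma modular_le_of_bounded:
  assumes \<Phi>: "musielak_orlicz M \<Phi>" and "0 < s" "s \<le> 1" "0 \<le> b"
    and bound: "\<And>x. x \<in> space M \<Longrightarrow> cmod (g x) \<le> s * b"
  shows "MO_modular M \<Phi> g \<le> ennreal s * (\<integral>\<^sup>+x. ennreal (\<Phi> x b) \<partial>M)"
proof -
  have "MO_modular M \<Phi> g \<le> (\<integral>\<^sup>+x. ennreal s * ennreal (\<Phi> x b) \<partial>M)"
    unfolding MO_modular_def
  proof (rule nn_integral_mono_AE)
    have "AE x in M. orlicz_function (\<Phi> x)"
      using \<Phi> by (simp add: musielak_orlicz_def)
    with AE_space[of M] show "AE x in M. ennreal (\<Phi> x (cmod (g x))) \<le> ennreal s * ennreal (\<Phi> x b)"
    proof eventually_elim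
      case (elim x)
      have "\<Phi> x (cmod (g x)) \<le> \<Phi> x (s * b)"
        using elim(2) norm_ge_zero bound[OF elim(1)] by (rule orlicz_function_mono)
      also have "\<dots> \<le> s * \<Phi> x b"
        using elim assms by (intro orlicz_function_scale) auto
      finally show ?case
        using assms elim by (simp add: ennreal_mult[symmetric] ennreal_leI orlicz_function_def)
    qed
  qed
  also have "\<dots> \<le> ennreal s * (\<integral>\<^sup>+x. ennreal (\<Phi> x b) \<partial>M)"
    using assms by (intro nn_integral_cmult_le)
  finally show ?thesis .
qed

text \<open>
  If the modular of \<open>\<rho> f\<close> is \<open>I < \<infinity>\<close>, convexity bounds that of \<open>s \<rho> f\<close> by \<open>s I\<close>, and a small \<open>s\<close>
  brings it below one. Hence the set in the definition of the Luxemburg norm is nonempty.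
\<close>

lemma MO_space_modular_le_1:
  assumes \<Phi>: "musielak_orlicz M \<Phi>" and f: "f \<in> MO_space M \<Phi>"
  obtains r where "0 < r" "MO_modular M \<Phi> (\<lambda>x. f x / complex_of_real r) \<le> 1"
proof -
  obtain \<rho> where "0 < \<rho>" and fin: "MO_modular M \<Phi> (\<lambda>x. complex_of_real \<rho> * f x) < \<infinity>"
    using f by (auto simp: MO_space_def)
  obtain I where "0 \<le> I" and I: "MO_modular M \<Phi> (\<lambda>x. complex_of_real \<rho> * f x) = ennreal I"
    using fin by (cases "MO_modular M \<Phi> (\<lambda>x. complex_of_real \<rho> * f x)") auto
  define s where "s = 1 / (I + 1)"
  have s: "0 < s" "s \<le> 1" "s * I \<le> 1"
    using \<open>0 \<le> I\<close> by (auto simp: s_def)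
  have "MO_modular M \<Phi> (\<lambda>x. f x / complex_of_real (1 / (s * \<rho>)))
      \<le> (\<integral>\<^sup>+x. ennreal s * ennreal (\<Phi> x (cmod (complex_of_real \<rho> * f x))) \<partial>M)"
    unfolding MO_modular_def
  proof (rule nn_integral_mono_AE)
    have "AE x in M. orlicz_function (\<Phi> x)"
      using \<Phi> by (simp add: musielak_orlicz_def)
    then show "AE x in M. ennreal (\<Phi> x (cmod (f x / complex_of_real (1 / (s * \<rho>)))))
        \<le> ennreal s * ennreal (\<Phi> x (cmod (complex_of_real \<rho> * f x)))"
    proof eventually_elim
      case (elim x)
      have "\<Phi> x (cmod (f x / complex_of_real (1 / (s * \<rho>))))
          = \<Phi> x (s * cmod (complex_of_real \<rho> * f x))"
        using s \<open>0 < \<rho>\<close> by (simp add: norm_mult norm_divide mult_ac)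
      also have "\<dots> \<le> s * \<Phi> x (cmod (complex_of_real \<rho> * f x))"
        using elim s by (intro orlicz_function_scale) auto
      finally show ?case
        using s elim by (simp add: ennreal_mult[symmetric] ennreal_leI orlicz_function_def)
    qed
  qed
  also have "\<dots> \<le> ennreal s * ennreal I"
    using nn_integral_cmult_le[OF \<open>0 < s\<close>] I unfolding MO_modular_def by metis
  also have "\<dots> \<le> 1"
    using s \<open>0 \<le> I\<close> by (simp add: ennreal_mult[symmetric])
  finally show thesis
    using that[of "1 / (s * \<rho>)"] s \<open>0 < \<rho>\<close> by simp
qed

section \<open>The Volterra operator\<close>

lemma emeasure_lebesgue_on_interval:
  fixes \<alpha> \<beta> :: real
  assumes "\<alpha> < \<beta>"
  shows "emeasure (lebesgue_on {\<alpha><..<\<beta>}) (space (lebesgue_on {\<alpha><..<\<beta>})) = ennreal (\<beta> - \<alpha>)"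
proof -
  have "emeasure (lebesgue_on {\<alpha><..<\<beta>}) {\<alpha><..<\<beta>} = emeasure lebesgue {\<alpha><..<\<beta>}"
    by (rule emeasure_restrict_space) auto
  then show ?thesis using assms by simp
qed

lemma set_integrable_initial_segment:
  fixes u :: "real \<Rightarrow> complex"
  assumes "set_integrable lebesgue {\<alpha><..<\<beta>} u" "x \<in> {\<alpha><..<\<beta>}"
  shows "set_integrable lebesgue {\<alpha><..<x} u"
  by (rule set_integrable_subset[OF assms(1)]) (use assms(2) in auto)

lemma set_integrable_of_MO_space:
  fixes \<alpha> \<beta> :: real
  assumes "\<alpha> < \<beta>" and \<Phi>: "musielak_orlicz (lebesgue_on {\<alpha><..<\<beta>}) \<Phi>" and "0 < a" "0 < c"
    and lower: "AE x in lebesgue_on {\<alpha><..<\<beta>}. c \<le> \<Phi> x a"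
    and u: "u \<in> MO_space (lebesgue_on {\<alpha><..<\<beta>}) \<Phi>"
  shows "set_integrable lebesgue {\<alpha><..<\<beta>} u"
proof -
  let ?M = "lebesgue_on {\<alpha><..<\<beta>}"
  have [measurable]: "u \<in> borel_measurable ?M"
    using u by (simp add: MO_space_def)
  obtain r where r: "0 < r" "MO_modular ?M \<Phi> (\<lambda>x. u x / complex_of_real r) \<le> 1"
    using MO_space_modular_le_1[OF \<Phi> u] .
  have "(\<integral>\<^sup>+x. ennreal (cmod (u x / complex_of_real r)) \<partial>?M)
      \<le> ennreal a * emeasure ?M (space ?M)
        + ennreal (a / c) * MO_modular ?M \<Phi> (\<lambda>x. u x / complex_of_real r)"
    using assms by (intro nn_integral_le_modular) auto
  also have "\<dots> < \<infinity>"
    using r \<open>\<alpha> < \<beta>\<close> unfolding emeasure_lebesgue_on_interval[OF \<open>\<alpha> < \<beta>\<close>]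
    by (auto simp: ennreal_mult_less_top intro: le_less_trans)
  finally have "integrable ?M (\<lambda>x. u x / complex_of_real r)"
    by (intro integrableI_bounded) auto
  then have "integrable ?M (\<lambda>x. complex_of_real r * (u x / complex_of_real r))"
    by (rule integrable_mult_right)
  then have "integrable ?M u"
    using r by simp
  then show ?thesis
    by (simp add: set_integrable_def integrable_restrict_space)
qed

text \<open>
  Up to the negligible endpoint \<open>\<alpha>\<close>, \<open>A u\<close> is an indefinite integral, hence continuous.
\<close>

lemma volterra_measurable:
  assumes u: "set_integrable lebesgue {\<alpha><..<\<beta>} u"
  shows "volterra \<alpha> u \<in> borel_measurable (lebesgue_on {\<alpha><..<\<beta>})"
proof -
  \<comment> \<open>The value of \<open>u\<close> outside the open interval is arbitrary, also at \<open>\<alpha>\<close>; hence the cut-off.\<close>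
  let ?v = "\<lambda>y. indicator {\<alpha><..<\<beta>} y *\<^sub>R u y"
  have v: "set_integrable lebesgue S ?v" if "S \<in> sets lebesgue" for S
    using integrable_mult_indicator[OF that u[unfolded set_integrable_def]]
    by (simp add: set_integrable_def)
  have "continuous_on {\<alpha>..\<beta>} (\<lambda>x. integral {\<alpha>..x} ?v)"
    using set_lebesgue_integral_eq_integral(1)[OF v] by (intro indefinite_integral_continuous_1) simp
  moreover have "integral {\<alpha>..x} ?v = volterra \<alpha> u x" if "x \<in> {\<alpha><..<\<beta>}" for x
  proof -
    have "integral {\<alpha>..x} ?v = (LINT y:{\<alpha>..x}|lebesgue. ?v y)"
      using v by (intro set_lebesgue_integral_eq_integral(2)[symmetric]) simp
    also have "\<dots> = integral\<^sup>L lebesgue (\<lambda>y. indicator {\<alpha>..x} y *\<^sub>R ?v y)"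
      by (simp add: set_lebesgue_integral_def)
    also have "\<dots> = integral\<^sup>L lebesgue (\<lambda>y. indicator {x} y *\<^sub>R u x + indicator {\<alpha><..<x} y *\<^sub>R u y)"
      using that by (intro Bochner_Integration.integral_cong) (auto split: split_indicator)
    also have "\<dots> = integral\<^sup>L lebesgue (\<lambda>y. indicator {x} y *\<^sub>R u x) + volterra \<alpha> u x"
      unfolding volterra_def set_lebesgue_integral_def
    proof (rule Bochner_Integration.integral_add)
      show "integrable lebesgue (\<lambda>y. indicator {\<alpha><..<x} y *\<^sub>R u y)"
        using set_integrable_initial_segment[OF u that] by (simp add: set_integrable_def)
    qed simp
    finally show ?thesis by simp
  qed
  ultimately have "continuous_on {\<alpha><..<\<beta>} (volterra \<alpha> u)"
    by (metis (no_types, lifting) continuous_on_cong continuous_on_subset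
        greaterThanLessThan_subseteq_atLeastAtMost_iff order_refl)
  then show ?thesis
    by (rule continuous_imp_measurable_on_sets_lebesgue) simp
qed

lemma norm_volterra_le:
  assumes u: "set_integrable lebesgue {\<alpha><..<\<beta>} u" and x: "x \<in> {\<alpha><..<\<beta>}"
  shows "ennreal (cmod (volterra \<alpha> u x)) \<le> (\<integral>\<^sup>+y. ennreal (cmod (u y)) \<partial>lebesgue_on {\<alpha><..<\<beta>})"
proof -
  have "set_integrable lebesgue {\<alpha><..<x} u"
    using u x by (rule set_integrable_initial_segment)
  then have "ennreal (cmod (volterra \<alpha> u x))
      \<le> (\<integral>\<^sup>+y. ennreal (cmod (indicator {\<alpha><..<x} y *\<^sub>R u y)) \<partial>lebesgue)"
    unfolding volterra_def set_lebesgue_integral_def set_integrable_def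
    by (rule integral_norm_bound_ennreal)
  also have "\<dots> \<le> (\<integral>\<^sup>+y. ennreal (cmod (u y)) * indicator {\<alpha><..<\<beta>} y \<partial>lebesgue)"
    using x by (intro nn_integral_mono) (auto split: split_indicator)
  also have "\<dots> = (\<integral>\<^sup>+y. ennreal (cmod (u y)) \<partial>lebesgue_on {\<alpha><..<\<beta>})"
    by (simp add: nn_integral_restrict_space)
  finally show ?thesis .
qed

lemma volterra_cong_AE:
  assumes u: "set_integrable lebesgue {\<alpha><..<\<beta>} u" and v: "set_integrable lebesgue {\<alpha><..<\<beta>} v"
    and eq: "AE y in lebesgue_on {\<alpha><..<\<beta>}. u y = v y" and x: "x \<in> {\<alpha><..<\<beta>}"
  shows "volterra \<alpha> u x = volterra \<alpha> v x"
  unfolding volterra_def set_lebesgue_integral_def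
proof (rule integral_cong_AE)
  show "(\<lambda>y. indicator {\<alpha><..<x} y *\<^sub>R u y) \<in> borel_measurable lebesgue"
    "(\<lambda>y. indicator {\<alpha><..<x} y *\<^sub>R v y) \<in> borel_measurable lebesgue"
    using set_integrable_initial_segment[OF u x] set_integrable_initial_segment[OF v x]
    unfolding set_integrable_def by (blast intro: borel_measurable_integrable)+
  have "AE y in lebesgue. y \<in> {\<alpha><..<\<beta>} \<longrightarrow> u y = v y"
    using eq by (simp add: AE_restrict_space_iff)
  then show "AE y in lebesgue. indicator {\<alpha><..<x} y *\<^sub>R u y = indicator {\<alpha><..<x} y *\<^sub>R v y"
    by eventually_elim (use x in \<open>auto split: split_indicator\<close>)
qed

text \<open>
  A function \<open>u / r\<close> of modular at most one has \<open>L\<^sup>1\<close>-norm at most \<open>K = a (\<beta> - \<alpha>) + a / c\<close>. The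
  modular of \<open>A u / (C r)\<close> is thus at most \<open>s B\<close> as soon as \<open>K / C = s b\<close>; the choice
  \<open>s = 1 / (B + 1)\<close> keeps both \<open>s\<close> and \<open>s B\<close> at most one, and dictates the value of \<open>C\<close>.
\<close>

lemma volterra_modular_le_1:
  fixes \<alpha> \<beta> a b B c :: real
  defines "C \<equiv> (a * (\<beta> - \<alpha>) + a / c) * (B + 1) / b"
  assumes "\<alpha> < \<beta>" and \<Phi>: "musielak_orlicz (lebesgue_on {\<alpha><..<\<beta>}) \<Phi>"
    and "0 < a" "0 < b" "0 < c" "0 \<le> B"
    and lower: "AE x in lebesgue_on {\<alpha><..<\<beta>}. c \<le> \<Phi> x a"
    and upper: "(\<integral>\<^sup>+x. ennreal (\<Phi> x b) \<partial>lebesgue_on {\<alpha><..<\<beta>}) \<le> ennreal B"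
    and u: "u \<in> MO_space (lebesgue_on {\<alpha><..<\<beta>}) \<Phi>"
    and "0 < r" and r: "MO_modular (lebesgue_on {\<alpha><..<\<beta>}) \<Phi> (\<lambda>x. u x / complex_of_real r) \<le> 1"
  shows "MO_modular (lebesgue_on {\<alpha><..<\<beta>}) \<Phi> (\<lambda>x. volterra \<alpha> u x / complex_of_real (C * r)) \<le> 1"
proof -
  let ?M = "lebesgue_on {\<alpha><..<\<beta>}"
  define K where "K = a * (\<beta> - \<alpha>) + a / c"
  define s where "s = 1 / (B + 1)"
  have "0 < K" using assms unfolding K_def by (intro add_pos_pos) auto
  have C: "C = K * (B + 1) / b" by (simp add: C_def K_def)
  have "0 < C" using \<open>0 < K\<close> \<open>0 \<le> B\<close> \<open>0 < b\<close> unfolding C by simp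
  have s: "0 < s" "s \<le> 1" "s * B \<le> 1" "K / C = s * b"
    using \<open>0 < K\<close> \<open>0 \<le> B\<close> \<open>0 < b\<close> by (auto simp: s_def C)
  have int: "set_integrable lebesgue {\<alpha><..<\<beta>} u"
    using \<open>\<alpha> < \<beta>\<close> \<Phi> \<open>0 < a\<close> \<open>0 < c\<close> lower u by (rule set_integrable_of_MO_space)
  have [measurable]: "u \<in> borel_measurable ?M"
    using u by (simp add: MO_space_def)
  have "(\<integral>\<^sup>+x. ennreal (cmod (u x / complex_of_real r)) \<partial>?M)
      \<le> ennreal a * emeasure ?M (space ?M)
        + ennreal (a / c) * MO_modular ?M \<Phi> (\<lambda>x. u x / complex_of_real r)"
    using \<Phi> \<open>0 < a\<close> \<open>0 < c\<close> lower by (rule nn_integral_le_modular) simp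
  also have "\<dots> \<le> ennreal a * ennreal (\<beta> - \<alpha>) + ennreal (a / c) * 1"
    using r unfolding emeasure_lebesgue_on_interval[OF \<open>\<alpha> < \<beta>\<close>]
    by (intro add_mono mult_left_mono) auto
  also have "\<dots> = ennreal K"
    using \<open>\<alpha> < \<beta>\<close> \<open>0 < a\<close> \<open>0 < c\<close> by (simp add: K_def ennreal_mult)
  finally have L1: "(\<integral>\<^sup>+x. ennreal (cmod (u x / complex_of_real r)) \<partial>?M) \<le> ennreal K" .
  have "cmod (volterra \<alpha> u x / complex_of_real (C * r)) \<le> s * b" if "x \<in> space ?M" for x
  proof -
    have "set_integrable lebesgue {\<alpha><..<\<beta>} (\<lambda>x. u x / complex_of_real r)"
      using int by (simp add: set_integrable_divide)
    from norm_volterra_le[OF this, of x] that L1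
    have "ennreal (cmod (volterra \<alpha> (\<lambda>x. u x / complex_of_real r) x)) \<le> ennreal K"
      by (auto intro: order_trans)
    then have "cmod (volterra \<alpha> u x / complex_of_real r) \<le> K"
      using \<open>0 < K\<close> by (simp add: volterra_def)
    then have "cmod (volterra \<alpha> u x / complex_of_real r) / C \<le> K / C"
      using \<open>0 < C\<close> by (intro divide_right_mono) auto
    then show ?thesis
      using s \<open>0 < C\<close> \<open>0 < r\<close> by (simp add: norm_divide norm_mult mult.commute)
  qed
  then have "MO_modular ?M \<Phi> (\<lambda>x. volterra \<alpha> u x / complex_of_real (C * r))
      \<le> ennreal s * (\<integral>\<^sup>+x. ennreal (\<Phi> x b) \<partial>?M)"
    using \<Phi> s \<open>0 < b\<close> by (intro modular_le_of_bounded) auto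
  also have "\<dots> \<le> ennreal s * ennreal B"
    using upper by (intro mult_left_mono) auto
  also have "\<dots> \<le> 1"
    using s \<open>0 \<le> B\<close> by (simp add: ennreal_mult[symmetric])
  finally show ?thesis .
qed

theorem theorem2p7:
  fixes \<alpha> \<beta> a b :: real and \<Phi> :: "real \<Rightarrow> real \<Rightarrow> real"
  assumes "\<alpha> < \<beta>"
    and "musielak_orlicz (lebesgue_on {\<alpha><..<\<beta>}) \<Phi>"
    and "a > 0" and "b > 0"
    and "(\<integral>\<^sup>+x. ennreal (\<Phi> x b) \<partial>lebesgue_on {\<alpha><..<\<beta>}) < \<infinity>"
    and "ess_inf (lebesgue_on {\<alpha><..<\<beta>}) (\<lambda>x. \<Phi> x a) > 0"
  shows "(\<forall>u\<in>MO_space (lebesgue_on {\<alpha><..<\<beta>}) \<Phi>. \<forall>x\<in>{\<alpha><..<\<beta>}.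
            set_integrable lebesgue {\<alpha><..<x} u) \<and>
         MO_bounded_linear_operator (lebesgue_on {\<alpha><..<\<beta>}) \<Phi> (volterra \<alpha>)"
proof -
  let ?M = "lebesgue_on {\<alpha><..<\<beta>}"
  let ?A = "volterra \<alpha>"
  let ?R = "\<lambda>f. {r. r > 0 \<and> MO_modular ?M \<Phi> (\<lambda>x. f x / complex_of_real r) \<le> 1}"
  note \<Phi> = assms(2)
  obtain c where c: "0 < c" "AE x in ?M. c \<le> \<Phi> x a"
    using ess_inf_pos_obtain[OF assms(6)] .
  obtain B where "0 \<le> B" and B: "(\<integral>\<^sup>+x. ennreal (\<Phi> x b) \<partial>?M) = ennreal B"
    using assms(5) by (cases "\<integral>\<^sup>+x. ennreal (\<Phi> x b) \<partial>?M") auto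
  define C where "C = (a * (\<beta> - \<alpha>) + a / c) * (B + 1) / b"
  have "0 < a * (\<beta> - \<alpha>) + a / c"
    using assms(1,3) c(1) by (intro add_pos_pos) auto
  then have "0 < C"
    using \<open>0 \<le> B\<close> assms(4) by (simp add: C_def)
  have scaled: "C * r \<in> ?R (?A f)" if "f \<in> MO_space ?M \<Phi>" "r \<in> ?R f" for f r
    using volterra_modular_le_1[OF assms(1) \<Phi> assms(3,4) c(1) \<open>0 \<le> B\<close> c(2) eq_refl[OF B] that(1), of r,
      folded C_def] that(2) \<open>0 < C\<close> by simp
  have nonempty: "?R f \<noteq> {}" if "f \<in> MO_space ?M \<Phi>" for f
    using MO_space_modular_le_1[OF \<Phi> that] by blast
  have int: "set_integrable lebesgue {\<alpha><..<\<beta>} f" if "f \<in> MO_space ?M \<Phi>" for f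
    using assms(1) \<Phi> assms(3) c that by (rule set_integrable_of_MO_space)
  have int_sub: "set_integrable lebesgue {\<alpha><..<x} f"
    if "f \<in> MO_space ?M \<Phi>" "x \<in> {\<alpha><..<\<beta>}" for f x
    using int[OF that(1)] that(2) by (rule set_integrable_initial_segment)
  have "?A f \<in> MO_space ?M \<Phi>" if f: "f \<in> MO_space ?M \<Phi>" for f
  proof -
    obtain r where "r \<in> ?R f" using nonempty[OF f] by blast
    with scaled[OF f this]
    have r: "0 < C * r" "MO_modular ?M \<Phi> (\<lambda>x. ?A f x / complex_of_real (C * r)) \<le> 1"
      by blast+
    then have "MO_modular ?M \<Phi> (\<lambda>x. complex_of_real (1 / (C * r)) * ?A f x) < \<infinity>"
      by (simp add: le_less_trans)
    moreover have "0 < 1 / (C * r)" using r(1) by simp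
    ultimately show ?thesis
      using volterra_measurable[OF int[OF f]] unfolding MO_space_def by blast
  qed
  moreover have "AE x in ?M. ?A f x = ?A g x"
    if "f \<in> MO_space ?M \<Phi>" "g \<in> MO_space ?M \<Phi>" "AE x in ?M. f x = g x" for f g
    using volterra_cong_AE[OF int[OF that(1)] int[OF that(2)] that(3)] by (intro AE_I2) simp
  moreover have "AE x in ?M. ?A (\<lambda>y. k * f y + d * g y) x = k * ?A f x + d * ?A g x"
    if "f \<in> MO_space ?M \<Phi>" "g \<in> MO_space ?M \<Phi>" for f g k d
    using int_sub[OF that(1)] int_sub[OF that(2)]
    by (intro AE_I2) (simp add: volterra_def set_integral_add(2))
  moreover have "luxemburg_norm ?M \<Phi> (?A f) \<le> C * luxemburg_norm ?M \<Phi> f"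
    if f: "f \<in> MO_space ?M \<Phi>" for f
  proof -
    have bdd: "bdd_below (?R (?A f))" by (rule bdd_belowI[of _ 0]) auto
    have "Inf (?R (?A f)) / C \<le> Inf (?R f)"
    proof (rule cInf_greatest[OF nonempty[OF f]])
      fix r assume "r \<in> ?R f"
      from cInf_lower[OF scaled[OF f this] bdd] show "Inf (?R (?A f)) / C \<le> r"
        using \<open>0 < C\<close> by (simp add: field_simps)
    qed
    then show ?thesis
      using \<open>0 < C\<close> by (simp add: luxemburg_norm_def field_simps)
  qed
  ultimately show ?thesis
    using int_sub unfolding MO_bounded_linear_operator_def by blast
qed

end
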